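(* Let $\nabla_1>0$ be an integer. There exists a distributed algorithm in the LOCAL model which, on every input graph $G$ with $\nabla_1(G)\le \nabla_1$, runs in a constant number of rounds and outputs a dominating set of $G$ of size $\mathcal{O}(\gamma(G))$; that is, there are constants $r$ and $c$ depending only on $\nabla_1$ such that the algorithm terminates after at most $r$ communication rounds and outputs a dominating set $D'$ with $|D'|\le c\cdot\gamma(G)$.
   Context: All graphs are finite, undirected and simple. In the LOCAL model the input graph is the communication network: each vertex is a processor with a unique identifier, initially knowing nothing about the graph; in each synchronous round every vertex may send arbitrary messages to its neighbours and perform arbitrary local computation; at the end each vertex decides whether it belongs to the output set. A dominating set of $G$ is a set $D\subseteq V(G)$ such that every vertex is in $D$ or has a neighbour in $D$; $\gamma(G)$ is the minimum size of a dominating set. A graph $H$ is a $1$-shallow minor of $G$ if $H$ can be obtained from $G$ by deleting vertices and edges and then contracting pairwise vertex-disjoint connected subgraphs of radius at most $1$ (i.e. stars) to single vertices. $\nabla_1(G)$ denotes the maximum of $|E(H)|/|V(H)|$ over all $1$-shallow minors $H$ of $G$. *)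

theory Defs
  imports Complex_Main
begin

text \<open>Finite simple graphs: vertex set V (a finite set of naturals; a vertex's
  natural number is its unique identifier) and a symmetric irreflexive edge
  relation E living on V.\<close>

definition graph :: "nat set \<Rightarrow> (nat \<Rightarrow> nat \<Rightarrow> bool) \<Rightarrow> bool" where
  "graph V E \<longleftrightarrow> finite V \<and> (\<forall>x y. E x y \<longrightarrow> x \<in> V \<and> y \<in> V \<and> x \<noteq> y \<and> E y x)"

definition dominating :: "nat set \<Rightarrow> (nat \<Rightarrow> nat \<Rightarrow> bool) \<Rightarrow> nat set \<Rightarrow> bool" where
  "dominating V E D \<longleftrightarrow> D \<subseteq> V \<and> (\<forall>v\<in>V. v \<in> D \<or> (\<exists>u\<in>D. E v u))"

definition domination_number :: "nat set \<Rightarrow> (nat \<Rightarrow> nat \<Rightarrow> bool) \<Rightarrow> nat" where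
  "domination_number V E = Min (card ` {D. dominating V E D})"

text \<open>A 1-shallow minor H of G, given by its model: the vertex set of H is a
  finite family P of pairwise disjoint branch sets, each inducing a star
  (a centre c adjacent to all other members) in G; the edge set F of H is a
  set of unordered pairs of distinct branch sets joined by an edge of G.\<close>

definition star_set :: "nat set \<Rightarrow> (nat \<Rightarrow> nat \<Rightarrow> bool) \<Rightarrow> nat set \<Rightarrow> bool" where
  "star_set V E B \<longleftrightarrow> B \<subseteq> V \<and> (\<exists>c\<in>B. \<forall>x\<in>B. x = c \<or> E c x)"

definition shallow1_minor ::
  "nat set \<Rightarrow> (nat \<Rightarrow> nat \<Rightarrow> bool) \<Rightarrow> nat set set \<Rightarrow> nat set set set \<Rightarrow> bool" where
  "shallow1_minor V E P F \<longleftrightarrow>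
     finite P \<and> (\<forall>B\<in>P. star_set V E B) \<and>
     (\<forall>B\<in>P. \<forall>B'\<in>P. B \<noteq> B' \<longrightarrow> B \<inter> B' = {}) \<and>
     (\<forall>e\<in>F. \<exists>B B'. e = {B, B'} \<and> B \<in> P \<and> B' \<in> P \<and> B \<noteq> B' \<and>
              (\<exists>x\<in>B. \<exists>y\<in>B'. E x y))"

definition nabla1_le :: "nat set \<Rightarrow> (nat \<Rightarrow> nat \<Rightarrow> bool) \<Rightarrow> nat \<Rightarrow> bool" where
  "nabla1_le V E d \<longleftrightarrow>
     (\<forall>P F. shallow1_minor V E P F \<and> P \<noteq> {} \<longrightarrow>
        real (card F) / real (card P) \<le> real d)"

text \<open>LOCAL model.  A deterministic algorithm is given by an initial state
  depending only on the vertex identifier, a message function (the message a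
  vertex sends to its neighbours, computed from its state), and a transition
  function mapping the current state and the set of messages received from
  the neighbours to the new state.  local_state gives the state of v after
  t synchronous rounds.\<close>

primrec local_state ::
  "(nat \<Rightarrow> 's) \<Rightarrow> ('s \<Rightarrow> 'm) \<Rightarrow> ('s \<Rightarrow> 'm set \<Rightarrow> 's) \<Rightarrow>
   nat set \<Rightarrow> (nat \<Rightarrow> nat \<Rightarrow> bool) \<Rightarrow> nat \<Rightarrow> nat \<Rightarrow> 's" where
  "local_state init msg step V E 0 v = init v"
| "local_state init msg step V E (Suc t) v =
     step (local_state init msg step V E t v)
           ((\<lambda>u. msg (local_state init msg step V E t u)) ` {u \<in> V. E v u})"

definition local_output ::
  "(nat \<Rightarrow> 's) \<Rightarrow> ('s \<Rightarrow> 'm) \<Rightarrow> ('s \<Rightarrow> 'm set \<Rightarrow> 's) \<Rightarrow> ('s \<Rightarrow> bool) \<Rightarrow> nat \<Rightarrow>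
   nat set \<Rightarrow> (nat \<Rightarrow> nat \<Rightarrow> bool) \<Rightarrow> nat set" where
  "local_output init msg step out r V E = {v \<in> V. out (local_state init msg step V E r v)}"

end

theory Submission
  imports Defs "HOL-Library.Nat_Bijection"
begin

text \<open>
  Let \<open>D\<close> be a minimum dominating set. Contracting the stars around the vertices of \<open>D\<close> shows that
  all but \<open>2d |D|\<close> vertices outside \<open>D\<close> have a closed neighbourhood covered by at most \<open>2d + 1\<close>
  vertices of \<open>D\<close>; call the exceptional ones scattered.

  Every vertex \<open>x\<close> has a locally computable candidate set of bounded size such that, for \<open>x\<close> neither
  in \<open>D\<close> nor scattered, every large subset of its closed neighbourhood is covered in a constant
  fraction by some candidate in \<open>D\<close>. A chain is a sequence of distinct vertices, each a candidate of
  its predecessor. As \<open>G\<close> has no large complete bipartite subgraphs, no chain with \<open>2d + 1\<close> vertices has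
  many common neighbours. For the lengths \<open>2d, 2d - 1, \<dots>, 1\<close> in turn, select the last vertices of all
  chains of that length with many common undominated neighbours. After each stage no such chain of
  that length remains, so at the next stage no chain can be prolonged; hence each of them contains a
  vertex that is in \<open>D\<close> or scattered, and its last vertex is reached from that one in boundedly many
  candidate steps. This bounds the number of selected vertices by \<open>O(|D|)\<close>. In the end every vertex
  has boundedly many undominated neighbours, so that all undominated vertices can be selected.
\<close>

section \<open>Edge counting in 1-shallow minors\<close>

definition cnbh :: "(nat \<Rightarrow> nat \<Rightarrow> bool) \<Rightarrow> nat \<Rightarrow> nat set" where
  "cnbh E v = insert v {u. E v u}"

lemma self_mem_cnbh [simp]: "v \<in> cnbh E v"
  by (simp add: cnbh_def)

lemma cnbh_sym: "symp E \<Longrightarrow> u \<in> cnbh E v \<longleftrightarrow> v \<in> cnbh E u"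
  by (auto simp: cnbh_def dest: sympD)

lemma graph_symp: "graph V E \<Longrightarrow> symp E"
  by (auto simp: graph_def symp_def)

lemma cnbh_subset: "graph V E \<Longrightarrow> v \<in> V \<Longrightarrow> cnbh E v \<subseteq> V"
  by (auto simp: graph_def cnbh_def)

lemma finite_cnbh: "graph V E \<Longrightarrow> finite (cnbh E v)"
  by (rule finite_subset[of _ "insert v V"]) (auto simp: cnbh_def graph_def)

lemma card_cnbh_ge_2_imp_vertex: "graph V E \<Longrightarrow> 2 \<le> card (cnbh E v) \<Longrightarrow> v \<in> V"
proof (rule ccontr)
  assume "graph V E" "2 \<le> card (cnbh E v)" "v \<notin> V"
  then have "cnbh E v = {v}" by (auto simp: cnbh_def graph_def)
  with \<open>2 \<le> card (cnbh E v)\<close> show False by simp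
qed

lemma card_arcs_le:
  assumes "finite A"
  shows "card A \<le> 2 * card ((\<lambda>(p, q). {p, q}) ` A)"
proof -
  let ?F = "(\<lambda>(p, q). {p, q}) ` A"
  have two: "card {a \<in> A. (case a of (p, q) \<Rightarrow> {p, q}) = e} \<le> 2" if "e \<in> ?F" for e
  proof -
    from that obtain p q where "e = {p, q}" by auto
    then have "a = (p, q) \<or> a = (q, p)" if "(case a of (p, q) \<Rightarrow> {p, q}) = e" for a
      using that by (cases a) (simp add: doubleton_eq_iff)
    then have "{a \<in> A. (case a of (p, q) \<Rightarrow> {p, q}) = e} \<subseteq> {(p, q), (q, p)}"
      by blast
    then have "card {a \<in> A. (case a of (p, q) \<Rightarrow> {p, q}) = e} \<le> card {(p, q), (q, p)}"
      by (intro card_mono) auto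
    also have "\<dots> \<le> 2" by (rule card_insert_le_m1) simp_all
    finally show ?thesis .
  qed
  have "A = (\<Union>e\<in>?F. {a \<in> A. (case a of (p, q) \<Rightarrow> {p, q}) = e})" by auto
  then have "card A \<le> (\<Sum>e\<in>?F. card {a \<in> A. (case a of (p, q) \<Rightarrow> {p, q}) = e})"
    using card_UN_le[of ?F "\<lambda>e. {a \<in> A. (case a of (p, q) \<Rightarrow> {p, q}) = e}"] assms by simp
  also have "\<dots> \<le> (\<Sum>e\<in>?F. 2)" by (intro sum_mono two)
  finally show ?thesis by simp
qed

text \<open>Contracting the stars \<open>\<phi> p\<close> yields a 1-shallow minor with
  \<open>card I\<close> vertices, hence with at most \<open>d * card I\<close> edges. The factor 2
  appears because \<open>A\<close> consists of ordered pairs.\<close>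

lemma star_minor_arcs_le:
  fixes \<phi> :: "nat \<Rightarrow> nat set"
  assumes nabla: "nabla1_le V E d" and "finite I"
    and star: "\<And>p. p \<in> I \<Longrightarrow> star_set V E (\<phi> p)"
    and disj: "\<And>p q. p \<in> I \<Longrightarrow> q \<in> I \<Longrightarrow> p \<noteq> q \<Longrightarrow> \<phi> p \<inter> \<phi> q = {}"
    and arcs: "\<And>p q. (p, q) \<in> A \<Longrightarrow>
      p \<in> I \<and> q \<in> I \<and> p \<noteq> q \<and> (\<exists>x\<in>\<phi> p. \<exists>y\<in>\<phi> q. E x y)"
  shows "card A \<le> 2 * d * card I"
proof (cases "I = {}")
  case True
  with arcs have "A = {}" by auto
  then show ?thesis by simp
next
  case False
  have nonempty: "\<phi> p \<noteq> {}" if "p \<in> I" for p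
    using star[OF that] by (auto simp: star_set_def)
  have inj: "inj_on \<phi> I"
    by (rule inj_onI) (metis disj nonempty inf.idem)
  have "A \<subseteq> I \<times> I" using arcs by auto
  then have finA: "finite A" using \<open>finite I\<close> by (meson finite_SigmaI finite_subset)
  let ?h = "\<lambda>(p, q). (\<phi> p, \<phi> q)"
  let ?F = "(\<lambda>(B, B'). {B, B'}) ` ?h ` A"
  have "inj_on ?h A"
    using inj arcs by (auto simp: inj_on_def)
  then have "card A = card (?h ` A)" by (simp add: card_image)
  also have "\<dots> \<le> 2 * card ?F" using finA by (intro card_arcs_le) simp
  finally have le: "card A \<le> 2 * card ?F" .
  have "shallow1_minor V E (\<phi> ` I) ?F"
    unfolding shallow1_minor_def
  proof (intro conjI ballI impI)
    show "finite (\<phi> ` I)" using \<open>finite I\<close> by simp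
    show "star_set V E B" if "B \<in> \<phi> ` I" for B using that star by auto
    show "B \<inter> B' = {}" if "B \<in> \<phi> ` I" "B' \<in> \<phi> ` I" "B \<noteq> B'" for B B'
      using that disj by blast
    fix e assume "e \<in> ?F"
    then obtain p q where pq: "(p, q) \<in> A" "e = {\<phi> p, \<phi> q}" by auto
    with arcs[OF pq(1)] inj
    show "\<exists>B B'. e = {B, B'} \<and> B \<in> \<phi> ` I \<and> B' \<in> \<phi> ` I \<and> B \<noteq> B' \<and> (\<exists>x\<in>B. \<exists>y\<in>B'. E x y)"
      by (intro exI[of _ "\<phi> p"] exI[of _ "\<phi> q"]) (auto dest: inj_onD)
  qed
  with nabla False have "real (card ?F) / real (card (\<phi> ` I)) \<le> real d"
    unfolding nabla1_le_def by blast
  moreover have "card (\<phi> ` I) = card I" using inj by (rule card_image)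
  moreover have "card I > 0" using False \<open>finite I\<close> by (simp add: card_gt_0_iff)
  ultimately have "real (card ?F) \<le> real (d * card I)"
    by (simp add: divide_le_eq)
  then have "card ?F \<le> d * card I" by (simp only: of_nat_le_iff)
  with le show ?thesis by simp
qed

text \<open>Take singleton branch sets on \<open>Z \<union> Y\<close>. A closed neighbourhood has at
  most one member besides the neighbours, its centre, which adds 1 to the factor of
  \<open>card Z\<close>.\<close>

lemma sum_card_cnbh_le:
  assumes g: "graph V E" and nabla: "nabla1_le V E d" and "Z \<subseteq> V" "Y \<subseteq> V"
  shows "(\<Sum>z\<in>Z. card (cnbh E z \<inter> Y)) \<le> (2 * d + 1) * card Z + 2 * d * card Y"
proof -
  have fin: "finite Z" "finite Y"
    using assms finite_subset unfolding graph_def by blast+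
  let ?A = "SIGMA z:Z. {y \<in> Y. E z y}"
  have "card ?A \<le> 2 * d * card (Z \<union> Y)"
  proof (rule star_minor_arcs_le[OF nabla, where \<phi> = "\<lambda>p. {p}"])
    show "finite (Z \<union> Y)" using fin by simp
  qed (use assms in \<open>auto simp: star_set_def graph_def\<close>)
  also have "\<dots> \<le> 2 * d * (card Z + card Y)"
    by (intro mult_left_mono card_Un_le) simp
  finally have A: "(\<Sum>z\<in>Z. card {y \<in> Y. E z y}) \<le> 2 * d * (card Z + card Y)"
    using fin by simp
  have "card (cnbh E z \<inter> Y) \<le> 1 + card {y \<in> Y. E z y}" for z
  proof -
    have "card (cnbh E z \<inter> Y) \<le> card (insert z {y \<in> Y. E z y})"
      using fin by (intro card_mono) (auto simp: cnbh_def)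
    also have "\<dots> \<le> 1 + card {y \<in> Y. E z y}"
      using fin by (simp add: card_insert_if)
    finally show ?thesis .
  qed
  then have "(\<Sum>z\<in>Z. card (cnbh E z \<inter> Y)) \<le> (\<Sum>z\<in>Z. 1 + card {y \<in> Y. E z y})"
    by (intro sum_mono)
  also have "\<dots> = card Z + (\<Sum>z\<in>Z. card {y \<in> Y. E z y})"
    by (simp only: sum.distrib card_eq_sum)
  finally show ?thesis using A by (simp add: algebra_simps)
qed

section \<open>Vertices whose closed neighbourhood needs many dominators\<close>

definition scattered :: "nat set \<Rightarrow> (nat \<Rightarrow> nat \<Rightarrow> bool) \<Rightarrow> nat \<Rightarrow> nat set \<Rightarrow> nat set" where
  "scattered V E k D = {v \<in> V - D. \<not> (\<exists>D'\<subseteq>D. card D' \<le> k \<and> cnbh E v \<subseteq> (\<Union>u\<in>D'. cnbh E u))}"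

text \<open>Contract each dominator with the non-scattered vertices assigned to it and keep
  scattered vertices as singletons. A scattered vertex with at most \<open>2 * d\<close> neighbours
  in this minor would be covered, with its neighbourhood, by their dominators and its own. So each
  has degree at least \<open>2 * d + 1\<close>, while the edge bound allows only
  \<open>2 * d * (card D + card ?S)\<close> arcs.\<close>

lemma card_scattered_le:
  assumes g: "graph V E" and nabla: "nabla1_le V E d" and dom: "dominating V E D"
  shows "card (scattered V E (2 * d + 1) D) \<le> 2 * d * card D"
proof -
  let ?S = "scattered V E (2 * d + 1) D"
  have finV: "finite V" and DV: "D \<subseteq> V" using g dom by (auto simp: graph_def dominating_def)
  then have finD: "finite D" using finite_subset by blast
  have SV: "?S \<subseteq> V" and SD: "?S \<inter> D = {}" by (auto simp: scattered_def)
  then have finS: "finite ?S" using finV finite_subset by blast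
  \<comment> \<open>A vertex of \<open>D\<close> is assigned to itself, so every dominator is the
    centre of its own branch set.\<close>
  have "\<exists>u\<in>D. w \<in> cnbh E u \<and> (w \<in> D \<longrightarrow> u = w)" if "w \<in> V" for w
    using dom that graph_symp[OF g] unfolding dominating_def cnbh_def
    by (metis insertI1 insertI2 mem_Collect_eq sympD)
  then obtain f where f: "\<And>w. w \<in> V \<Longrightarrow> f w \<in> D \<and> w \<in> cnbh E (f w) \<and> (w \<in> D \<longrightarrow> f w = w)"
    by metis
  define r where "r w = (if w \<in> ?S then w else f w)" for w
  define \<phi> where "\<phi> p = {w \<in> V. r w = p}" for p
  let ?I = "D \<union> ?S"
  let ?N = "\<lambda>v. r ` {w. E v w}"
  let ?A = "SIGMA v:?S. ?N v"
  have rep: "r p = p" if "p \<in> ?I" for p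
    using that f DV SD by (auto simp: r_def)
  have EV: "x \<in> V \<and> y \<in> V \<and> x \<noteq> y" if "E x y" for x y
    using g that by (auto simp: graph_def)
  have rI: "r w \<in> ?I" if "w \<in> V" for w
    using f[OF that] by (auto simp: r_def)
  have finN: "finite (?N v)" for v
    by (rule finite_imageI, rule finite_subset[OF _ finV]) (use EV in auto)
  have "card ?A \<le> 2 * d * card ?I"
  proof (rule star_minor_arcs_le[OF nabla, where \<phi> = \<phi>])
    show "finite ?I" using finD finS by simp
    show "star_set V E (\<phi> p)" if "p \<in> ?I" for p
    proof -
      have "p \<in> \<phi> p" using that rep DV SV by (auto simp: \<phi>_def)
      moreover have "w = p \<or> E p w" if "w \<in> \<phi> p" for w
        using that f[of w] by (auto simp: \<phi>_def r_def cnbh_def split: if_splits)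
      ultimately show ?thesis unfolding star_set_def by (auto simp: \<phi>_def)
    qed
    show "\<phi> p \<inter> \<phi> q = {}" if "p \<noteq> q" for p q using that by (auto simp: \<phi>_def)
    fix v q assume "(v, q) \<in> ?A"
    then obtain w where v: "v \<in> ?S" and w: "E v w" "q = r w" by auto
    have "q \<in> ?I" using w rI EV by blast
    moreover have "v \<noteq> q"
    proof
      assume "v = q"
      then show False using w v EV[OF w(1)] f[of w] SD by (auto simp: r_def split: if_splits)
    qed
    moreover have "v \<in> \<phi> v" "w \<in> \<phi> q"
      using v w EV[OF w(1)] rep by (auto simp: \<phi>_def)
    ultimately show "v \<in> ?I \<and> q \<in> ?I \<and> v \<noteq> q \<and> (\<exists>x\<in>\<phi> v. \<exists>y\<in>\<phi> q. E x y)"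
      using v w by blast
  qed
  also have "card ?I \<le> card D + card ?S" by (rule card_Un_le)
  finally have upper: "card ?A \<le> 2 * d * (card D + card ?S)" by simp
  have deg: "2 * d + 1 \<le> card (?N v)" if v: "v \<in> ?S" for v
  proof (rule ccontr)
    assume small: "\<not> 2 * d + 1 \<le> card (?N v)"
    \<comment> \<open>\<open>f v\<close> is there to cover \<open>v\<close> itself; it raises the
      count from \<open>2 * d\<close> to \<open>2 * d + 1\<close>.\<close>
    let ?D' = "insert (f v) (f ` ?N v)"
    have "v \<in> V" using v SV by auto
    have rV: "r w \<in> V" if "w \<in> V" for w using rI[OF that] DV SV by auto
    have "?D' \<subseteq> D" using f \<open>v \<in> V\<close> rV EV by blast
    moreover have "card ?D' \<le> 2 * d + 1"
      using small card_image_le[OF finN, of f v] finN[of v] by (simp add: card_insert_if)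
    moreover have "cnbh E v \<subseteq> (\<Union>u\<in>?D'. cnbh E u)"
    proof
      fix w assume "w \<in> cnbh E v"
      then consider "w = v" | "E v w" by (auto simp: cnbh_def)
      then show "w \<in> (\<Union>u\<in>?D'. cnbh E u)"
      proof cases
        case 1 then show ?thesis using f[OF \<open>v \<in> V\<close>] by auto
      next
        case 2
        then have "w \<in> V" using EV by auto
        \<comment> \<open>\<open>r w\<close> is \<open>w\<close> or \<open>f w\<close>, and
          \<open>f\<close> fixes \<open>D\<close>.\<close>
        then have "f (r w) = f w" using f[of w] f[of "f w"] DV by (auto simp: r_def)
        then show ?thesis using 2 f[OF \<open>w \<in> V\<close>] by auto
      qed
    qed
    ultimately show False using v unfolding scattered_def by blast
  qed
  have "(2 * d + 1) * card ?S = (\<Sum>v\<in>?S. 2 * d + 1)" by simp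
  also have "\<dots> \<le> (\<Sum>v\<in>?S. card (?N v))" by (intro sum_mono deg)
  also have "\<dots> = card ?A" using finS finN by simp
  finally have "(2 * d + 1) * card ?S \<le> 2 * d * (card D + card ?S)" using upper by simp
  then show ?thesis by (simp add: algebra_simps)
qed

section \<open>Pseudo-covers and chains\<close>

text \<open>One more than the largest \<open>card Y\<close> for which the double counting in
  \<open>heavy_vertices\<close> tolerates \<open>2 * d * (2 * d + 1) + 1\<close> heavy
  vertices.\<close>

definition cand_thr :: "nat \<Rightarrow> nat" where
  "cand_thr d = (2 * d + 1)\<^sup>2 * (2 * d * (2 * d + 1) + 1) + 1"

text \<open>All vertices that a greedy cover of \<open>Y\<close> by \<open>k\<close> closed neighbourhoods may use before fewer
  than \<open>cand_thr d\<close> vertices are left, where every choice covers a \<open>1/(2d+1)\<close> fraction of the rest.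
  Stopping early is what keeps the number of candidates bounded.\<close>

primrec cands :: "(nat \<Rightarrow> nat \<Rightarrow> bool) \<Rightarrow> nat \<Rightarrow> nat \<Rightarrow> nat set \<Rightarrow> nat set" where
  "cands E d 0 Y = {}"
| "cands E d (Suc k) Y =
     (if card Y < cand_thr d then {}
      else \<Union>w\<in>{w. card Y \<le> (2 * d + 1) * card (cnbh E w \<inter> Y)}. insert w (cands E d k (Y - cnbh E w)))"

abbreviation ncands :: "(nat \<Rightarrow> nat \<Rightarrow> bool) \<Rightarrow> nat \<Rightarrow> nat \<Rightarrow> nat set" where
  "ncands E d x \<equiv> cands E d (2 * d + 1) (cnbh E x)"

primrec cands_bound :: "nat \<Rightarrow> nat \<Rightarrow> nat" where
  "cands_bound d 0 = 0"
| "cands_bound d (Suc k) = 2 * d * (2 * d + 1) * (1 + cands_bound d k)"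

text \<open>Double counting: \<open>?n\<close> heavy vertices have at least
  \<open>?n * card Y / ?K\<close> incidences with \<open>Y\<close>, but the edge bound permits only
  \<open>?K * ?n + 2 * d * card Y\<close>, which is less once \<open>Y\<close> is large.\<close>

lemma heavy_vertices:
  assumes g: "graph V E" and nabla: "nabla1_le V E d" and Y: "Y \<subseteq> V" "cand_thr d \<le> card Y"
  defines "W \<equiv> {w. card Y \<le> (2 * d + 1) * card (cnbh E w \<inter> Y)}"
  shows "W \<subseteq> V" "card W \<le> 2 * d * (2 * d + 1)"
proof -
  let ?K = "2 * d + 1" and ?n = "2 * d * (2 * d + 1) + 1"
  have pos: "card Y > 0" using Y by (simp add: cand_thr_def)
  show WV: "W \<subseteq> V"
  proof
    fix w assume "w \<in> W"
    then have "cnbh E w \<inter> Y \<noteq> {}" using pos unfolding W_def by (metis card.empty mem_Collect_eq mult_0_right not_le)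
    then show "w \<in> V" using Y g by (auto simp: cnbh_def graph_def)
  qed
  show "card W \<le> 2 * d * (2 * d + 1)"
  proof (rule ccontr)
    assume "\<not> ?thesis"
    then have "?n \<le> card W" by simp
    then obtain Z where Z: "Z \<subseteq> W" "card Z = ?n" by (meson obtain_subset_with_card_n)
    have "?n * card Y = (\<Sum>z\<in>Z. card Y)" by (simp only: sum_constant Z of_nat_id)
    also have "\<dots> \<le> (\<Sum>z\<in>Z. ?K * card (cnbh E z \<inter> Y))"
      using Z by (intro sum_mono) (auto simp: W_def)
    also have "\<dots> = ?K * (\<Sum>z\<in>Z. card (cnbh E z \<inter> Y))" by (simp only: sum_distrib_left)
    also have "\<dots> \<le> ?K * (?K * ?n + 2 * d * card Y)"
      using sum_card_cnbh_le[OF g nabla, of Z Y] Z Y WV by (intro mult_left_mono) auto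
    finally have "?n * card Y \<le> ?K * (?K * ?n) + (2 * d * ?K) * card Y"
      by (simp only: algebra_simps)
    \<comment> \<open>The coefficient of \<open>card Y\<close> on the left exceeds the one on the
      right by exactly 1, which dictates the choice of \<open>?n\<close>.\<close>
    moreover have "?n * card Y = (2 * d * ?K) * card Y + card Y" by (simp only: distrib_right mult_1)
    ultimately have "card Y \<le> ?K * (?K * ?n)" by linarith
    moreover have "cand_thr d = ?K * (?K * ?n) + 1"
      unfolding cand_thr_def power2_eq_square by (simp only: mult.assoc)
    ultimately show False using Y by linarith
  qed
qed

lemma card_cands_le:
  assumes g: "graph V E" and nabla: "nabla1_le V E d"
  shows "Y \<subseteq> V \<Longrightarrow> cands E d k Y \<subseteq> V \<and> card (cands E d k Y) \<le> cands_bound d k"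
proof (induction k arbitrary: Y)
  case 0
  then show ?case by simp
next
  case (Suc k)
  show ?case
  proof (cases "card Y < cand_thr d")
    case True
    then show ?thesis by simp
  next
    case False
    let ?W = "{w. card Y \<le> (2 * d + 1) * card (cnbh E w \<inter> Y)}"
    have W: "?W \<subseteq> V" "card ?W \<le> 2 * d * (2 * d + 1)"
      using heavy_vertices[OF g nabla Suc.prems] False by simp_all
    have finW: "finite ?W" using W(1) g finite_subset unfolding graph_def by blast
    have IH: "cands E d k (Y - cnbh E w) \<subseteq> V \<and> card (cands E d k (Y - cnbh E w)) \<le> cands_bound d k" for w
      using Suc by blast
    have fin: "finite (cands E d k (Y - cnbh E w))" for w
      using IH[of w] g unfolding graph_def by (meson finite_subset)
    let ?U = "\<Union>w\<in>?W. insert w (cands E d k (Y - cnbh E w))"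
    have "card ?U \<le> (\<Sum>w\<in>?W. card (insert w (cands E d k (Y - cnbh E w))))"
      by (rule card_UN_le[OF finW])
    also have "\<dots> \<le> (\<Sum>w\<in>?W. 1 + cands_bound d k)"
      using IH fin by (intro sum_mono) (simp add: card_insert_if le_SucI)
    also have "\<dots> = card ?W * (1 + cands_bound d k)" by simp
    also have "\<dots> \<le> cands_bound d (Suc k)"
      unfolding cands_bound.simps using W(2) by (rule mult_right_mono) simp
    finally have "card ?U \<le> cands_bound d (Suc k)" .
    moreover have "?U \<subseteq> V" using W(1) IH by blast
    moreover have "cands E d (Suc k) Y = ?U" using False by simp
    ultimately show ?thesis by simp
  qed
qed

text \<open>Greedy argument: by averaging, some \<open>w\<close> in \<open>D'\<close> covers a
  \<open>1/(2d+1)\<close> fraction of \<open>Y\<close> and is a candidate. If it covers fewer than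
  \<open>t\<close> elements of \<open>B\<close>, discard it with its closed neighbourhood. Then
  \<open>k\<close> drops by one and \<open>B\<close> loses fewer than \<open>t\<close> elements, so
  the size condition persists and the greedy cover does not stop early.\<close>

lemma cands_hit_cover:
  assumes fin: "finite Y" and "finite D'" "card D' \<le> k" "k \<le> 2 * d + 1"
    and "Y \<subseteq> (\<Union>u\<in>D'. cnbh E u)" "B \<subseteq> Y" "cand_thr d + k * t \<le> card B"
  shows "\<exists>w\<in>D' \<inter> cands E d k Y. t \<le> card (cnbh E w \<inter> B)"
  using assms
proof (induction k arbitrary: Y D' B)
  case 0
  then have "B = {}" by auto
  then show ?case using 0 by (simp add: cand_thr_def)
next
  case (Suc k)
  have BY: "card B \<le> card Y" using Suc.prems by (intro card_mono)
  have big: "cand_thr d \<le> card Y" using BY Suc.prems by simp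
  have "\<exists>w\<in>D'. card Y \<le> (2 * d + 1) * card (cnbh E w \<inter> Y)"
  proof (rule ccontr)
    assume "\<not> ?thesis"
    then have small: "(2 * d + 1) * card (cnbh E w \<inter> Y) < card Y" if "w \<in> D'" for w
      using that by (meson not_le)
    have "Y = (\<Union>w\<in>D'. cnbh E w \<inter> Y)" using Suc.prems by auto
    then have "card Y \<le> (\<Sum>w\<in>D'. card (cnbh E w \<inter> Y))"
      using card_UN_le[OF \<open>finite D'\<close>, of "\<lambda>w. cnbh E w \<inter> Y"] by simp
    then have le: "(2 * d + 1) * card Y \<le> (\<Sum>w\<in>D'. (2 * d + 1) * card (cnbh E w \<inter> Y))"
      by (simp only: sum_distrib_left[symmetric] mult_le_mono2)
    have "D' \<noteq> {}" using big Suc.prems(5) by (auto simp: cand_thr_def)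
    then have "(\<Sum>w\<in>D'. (2 * d + 1) * card (cnbh E w \<inter> Y)) < (\<Sum>w\<in>D'. card Y)"
      using small Suc.prems(2) by (intro sum_strict_mono) auto
    also have "\<dots> = card D' * card Y" by simp
    also have "\<dots> \<le> (2 * d + 1) * card Y"
      using Suc.prems by (intro mult_right_mono) auto
    finally show False using le by linarith
  qed
  then obtain w where w: "w \<in> D'" "card Y \<le> (2 * d + 1) * card (cnbh E w \<inter> Y)" by blast
  then have sub: "insert w (cands E d k (Y - cnbh E w)) \<subseteq> cands E d (Suc k) Y"
    using big by auto
  show ?case
  proof (cases "t \<le> card (cnbh E w \<inter> B)")
    case True
    then show ?thesis using w sub by blast
  next
    case False
    have finB: "finite B" using Suc.prems finite_subset by blast
    have "card B = card (cnbh E w \<inter> B) + card (B - cnbh E w)"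
      by (metis card_Int_Diff finB inf_commute)
    then have "cand_thr d + k * t \<le> card (B - cnbh E w)"
      using False Suc.prems(7) by simp
    then have "\<exists>v\<in>(D' - {w}) \<inter> cands E d k (Y - cnbh E w). t \<le> card (cnbh E v \<inter> (B - cnbh E w))"
      using Suc.prems w(1) by (intro Suc.IH) auto
    then obtain v where v: "v \<in> D'" "v \<in> cands E d k (Y - cnbh E w)"
      "t \<le> card (cnbh E v \<inter> (B - cnbh E w))" by blast
    have "card (cnbh E v \<inter> (B - cnbh E w)) \<le> card (cnbh E v \<inter> B)"
      using finB by (intro card_mono) auto
    then show ?thesis using v sub by (meson IntI insertCI le_trans subsetD)
  qed
qed

section \<open>Chains and the vertices reached by candidate steps\<close>

text \<open>Only the vertex set and the last vertex are recorded: the set for distinctness and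
  common neighbours, the last vertex for prolongation.\<close>

inductive chain :: "(nat \<Rightarrow> nat \<Rightarrow> bool) \<Rightarrow> nat \<Rightarrow> nat set \<Rightarrow> nat \<Rightarrow> bool" for E d where
  single: "chain E d {x} x"
| extend: "chain E d X x \<Longrightarrow> w \<in> ncands E d x \<Longrightarrow> w \<notin> X \<Longrightarrow> chain E d (insert w X) w"

lemma chain_finite: "chain E d X x \<Longrightarrow> finite X"
  by (induction rule: chain.induct) auto

lemma chain_end: "chain E d X x \<Longrightarrow> x \<in> X"
  by (induction rule: chain.induct) auto

primrec reach :: "(nat \<Rightarrow> nat \<Rightarrow> bool) \<Rightarrow> nat \<Rightarrow> nat \<Rightarrow> nat set \<Rightarrow> nat set" where
  "reach E d 0 A = A"
| "reach E d (Suc i) A = reach E d i A \<union> (\<Union>x\<in>reach E d i A. ncands E d x)"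

lemma reach_mono: "i \<le> j \<Longrightarrow> reach E d i A \<subseteq> reach E d j A"
  by (rule lift_Suc_mono_le[where f = "\<lambda>i. reach E d i A"]) auto

text \<open>After a vertex of \<open>A\<close> the chain goes on by candidate steps, fewer than
  \<open>card X\<close> of them.\<close>

lemma chain_end_reach: "chain E d X x \<Longrightarrow> X \<inter> A \<noteq> {} \<Longrightarrow> x \<in> reach E d (card X) A"
proof (induction rule: chain.induct)
  case (single x)
  then show ?case by auto
next
  case (extend X x w)
  have c: "card (insert w X) = Suc (card X)"
    using extend.hyps chain_finite by simp
  show ?case
  proof (cases "w \<in> A")
    case True
    then show ?thesis using reach_mono[of 0 "card (insert w X)" E d A] by auto
  next
    case False
    then have "x \<in> reach E d (card X) A" using extend by auto
    then show ?thesis using extend.hyps unfolding c by (auto simp del: cands.simps)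
  qed
qed

lemma card_reach_le:
  assumes g: "graph V E" and nabla: "nabla1_le V E d" and "A \<subseteq> V"
  shows "reach E d i A \<subseteq> V \<and> card (reach E d i A) \<le> (1 + cands_bound d (2 * d + 1)) ^ i * card A"
proof (induction i)
  case 0
  then show ?case using assms by simp
next
  case (Suc i)
  let ?R = "reach E d i A" and ?q = "cands_bound d (2 * d + 1)"
  have q: "ncands E d x \<subseteq> V \<and> card (ncands E d x) \<le> ?q" if "x \<in> ?R" for x
    using card_cands_le[OF g nabla] cnbh_subset[OF g] Suc that by (meson subsetD)
  have fin: "finite ?R" using Suc g finite_subset unfolding graph_def by blast
  have "card (\<Union>x\<in>?R. ncands E d x) \<le> (\<Sum>x\<in>?R. card (ncands E d x))"
    by (rule card_UN_le[OF fin])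
  also have "\<dots> \<le> (\<Sum>x\<in>?R. ?q)" using q by (intro sum_mono) blast
  also have "\<dots> = card ?R * ?q" by simp
  finally have "card (reach E d (Suc i) A) \<le> card ?R + card ?R * ?q"
    unfolding reach.simps by (meson add_left_mono card_Un_le le_trans)
  also have "\<dots> = (1 + ?q) * card ?R" by (simp only: algebra_simps)
  also have "\<dots> \<le> (1 + ?q) * ((1 + ?q) ^ i * card A)"
    using Suc by (intro mult_left_mono) auto
  also have "\<dots> = (1 + ?q) ^ Suc i * card A" by (simp only: power_Suc mult.assoc)
  finally show ?case using Suc q by (simp del: cands.simps cands_bound.simps) blast
qed

section \<open>The dominating set\<close>

text \<open>The base value exceeds what the edge bound allows as common part of
  \<open>2 * d + 1\<close> closed neighbourhoods. The recursion is the size demanded by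
  \<open>cands_hit_cover\<close> for \<open>k = 2 * d + 1\<close> and
  \<open>t = thr d j\<close>.\<close>

primrec thr :: "nat \<Rightarrow> nat \<Rightarrow> nat" where
  "thr d 0 = (2 * d + 1)\<^sup>2 + 1"
| "thr d (Suc j) = cand_thr d + (2 * d + 1) * thr d j"

definition ends :: "(nat \<Rightarrow> nat \<Rightarrow> bool) \<Rightarrow> nat \<Rightarrow> nat \<Rightarrow> nat set \<Rightarrow> nat set" where
  "ends E d j U =
     {x. \<exists>X. chain E d X x \<and> card X = 2 * d - j \<and> thr d (Suc j) \<le> card (U \<inter> (\<Inter>p\<in>X. cnbh E p))}"

text \<open>Starting from \<open>UNIV\<close> instead of \<open>V\<close> makes the construction
  depend on \<open>E\<close> alone, which suits the locality argument.\<close>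

primrec undom :: "(nat \<Rightarrow> nat \<Rightarrow> bool) \<Rightarrow> nat \<Rightarrow> nat \<Rightarrow> nat set" where
  "undom E d 0 = UNIV"
| "undom E d (Suc j) = undom E d j - (\<Union>x\<in>ends E d j (undom E d j). cnbh E x)"

definition dom_alg :: "(nat \<Rightarrow> nat \<Rightarrow> bool) \<Rightarrow> nat \<Rightarrow> nat set" where
  "dom_alg E d = (\<Union>j<2 * d. ends E d j (undom E d j)) \<union> undom E d (2 * d)"

lemma thr_ge_2: "2 \<le> thr d j"
proof (induction j)
  case 0
  then show ?case by (simp add: power2_eq_square)
next
  case (Suc j)
  then have "2 \<le> 1 * thr d j" by simp
  also have "\<dots> \<le> (2 * d + 1) * thr d j" by (intro mult_right_mono) auto
  finally show ?case by simp
qed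

text \<open>A number outside \<open>V\<close> has a singleton closed neighbourhood, while all
  thresholds are at least 2.\<close>

lemma thick_chain_subset:
  assumes g: "graph V E" and "thr d i \<le> card (U \<inter> (\<Inter>p\<in>X. cnbh E p))"
  shows "X \<subseteq> V"
proof
  fix p assume "p \<in> X"
  then have "card (U \<inter> (\<Inter>p\<in>X. cnbh E p)) \<le> card (cnbh E p)"
    using finite_cnbh[OF g] by (intro card_mono) auto
  then have "2 \<le> card (cnbh E p)" using assms(2) thr_ge_2[of d i] by linarith
  then show "p \<in> V" by (rule card_cnbh_ge_2_imp_vertex[OF g])
qed

lemma ends_subset:
  assumes "graph V E"
  shows "ends E d j U \<subseteq> V"
proof
  fix x assume "x \<in> ends E d j U"
  then obtain X where X: "chain E d X x" "thr d (Suc j) \<le> card (U \<inter> (\<Inter>p\<in>X. cnbh E p))"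
    unfolding ends_def by blast
  show "x \<in> V" using thick_chain_subset[OF assms X(2)] chain_end[OF X(1)] by blast
qed

text \<open>The invariant of the stages. For \<open>j = 0\<close> it is the absence of large
  complete bipartite subgraphs; afterwards it holds because the preceding stage selected the ends of
  all such chains.\<close>

lemma no_thick_chain:
  assumes g: "graph V E" and nabla: "nabla1_le V E d" and "j \<le> 2 * d"
    and ch: "chain E d X x" and X: "card X = 2 * d + 1 - j"
  shows "card (undom E d j \<inter> (\<Inter>p\<in>X. cnbh E p)) < thr d j"
proof (rule ccontr)
  let ?B = "undom E d j \<inter> (\<Inter>p\<in>X. cnbh E p)"
  assume "\<not> ?thesis"
  then have thick: "thr d j \<le> card ?B" by simp
  then have XV: "X \<subseteq> V" by (rule thick_chain_subset[OF g])
  have xX: "x \<in> X" by (rule chain_end[OF ch])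
  show False
  proof (cases j)
    case 0
    have "?B \<subseteq> cnbh E x" using xX by auto
    then have BV: "?B \<subseteq> V" using cnbh_subset[OF g] XV xX by blast
    \<comment> \<open>Each of the \<open>2 * d + 1\<close> vertices in \<open>X\<close> covers all
      of \<open>?B\<close>, so the edge bound leaves
      \<open>card ?B \<le> (2 * d + 1) * card X\<close>.\<close>
    have "(2 * d + 1) * card ?B = (\<Sum>p\<in>X. card ?B)" using X 0 by simp
    also have "\<dots> = (\<Sum>p\<in>X. card (cnbh E p \<inter> ?B))"
      by (intro sum.cong refl arg_cong[where f = card]) auto
    also have "\<dots> \<le> (2 * d + 1) * card X + 2 * d * card ?B"
      by (rule sum_card_cnbh_le[OF g nabla XV BV])
    finally have "card ?B \<le> (2 * d + 1) * card X" by simp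
    then have "card ?B \<le> (2 * d + 1)\<^sup>2" using X 0 by (simp add: power2_eq_square)
    then show False using thick 0 by simp
  next
    case (Suc i)
    let ?B' = "undom E d i \<inter> (\<Inter>p\<in>X. cnbh E p)"
    have "finite ?B'" using xX finite_cnbh[OF g, of x] by (rule_tac finite_subset[of _ "cnbh E x"]) auto
    then have "card ?B \<le> card ?B'" using Suc by (intro card_mono) auto
    then have "x \<in> ends E d i (undom E d i)"
      unfolding ends_def using ch X thick Suc by (auto intro!: exI[of _ X])
    \<comment> \<open>Selecting \<open>x\<close> removed all of \<open>cnbh E x\<close>, which
      contains \<open>?B\<close>.\<close>
    then have "?B = {}" using Suc xX by auto
    then show False using thick thr_ge_2[of d j]
    by (metis card.empty not_less_eq_eq numeral_2_eq_2 le_trans zero_le)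
  qed
qed

text \<open>If \<open>x\<close> is neither in \<open>D\<close> nor scattered, few dominators cover
  its closed neighbourhood, and one of them is a candidate that keeps \<open>thr d j\<close>
  elements of \<open>?B\<close>. Were it outside \<open>X\<close>, it would prolong the chain
  against \<open>no_thick_chain\<close>; so it lies in \<open>X\<close>.\<close>

lemma chain_meets_dominators:
  assumes g: "graph V E" and nabla: "nabla1_le V E d" and dom: "dominating V E D" and j: "j < 2 * d"
    and ch: "chain E d X x" and X: "card X = 2 * d - j"
    and thick: "thr d (Suc j) \<le> card (undom E d j \<inter> (\<Inter>p\<in>X. cnbh E p))"
  shows "X \<inter> (D \<union> scattered V E (2 * d + 1) D) \<noteq> {}"
proof (cases "x \<in> D \<union> scattered V E (2 * d + 1) D")
  case True
  then show ?thesis using chain_end[OF ch] by blast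
next
  case False
  let ?B = "undom E d j \<inter> (\<Inter>p\<in>X. cnbh E p)"
  have xX: "x \<in> X" by (rule chain_end[OF ch])
  then have "x \<in> V" using thick_chain_subset[OF g thick] by blast
  then obtain D' where D': "D' \<subseteq> D" "card D' \<le> 2 * d + 1" "cnbh E x \<subseteq> (\<Union>u\<in>D'. cnbh E u)"
    using False unfolding scattered_def by blast
  have "finite D'" using D'(1) dom g unfolding dominating_def graph_def by (meson finite_subset)
  then have "\<exists>w\<in>D' \<inter> ncands E d x. thr d j \<le> card (cnbh E w \<inter> ?B)"
    using D' thick xX finite_cnbh[OF g] by (intro cands_hit_cover) auto
  then obtain w where w: "w \<in> D'" "w \<in> ncands E d x" "thr d j \<le> card (cnbh E w \<inter> ?B)" by blast
  have "w \<in> X"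
  proof (rule ccontr)
    assume "w \<notin> X"
    then have "chain E d (insert w X) w" by (rule chain.extend[OF ch w(2)])
    moreover have "card (insert w X) = 2 * d + 1 - j"
      using \<open>w \<notin> X\<close> X j chain_finite[OF ch] by simp
    ultimately have "card (undom E d j \<inter> (\<Inter>p\<in>insert w X. cnbh E p)) < thr d j"
      using j by (intro no_thick_chain[OF g nabla]) auto
    moreover have "undom E d j \<inter> (\<Inter>p\<in>insert w X. cnbh E p) = cnbh E w \<inter> ?B" by auto
    ultimately show False using w(3) by simp
  qed
  then show ?thesis using w D' by blast
qed

text \<open>All ends are reached in at most \<open>2 * d\<close> candidate steps from the dominators
  and scattered vertices, at most \<open>(2 * d + 1) * card D\<close> in number; each step
  multiplies the bound by \<open>1 + cands_bound d (2 * d + 1)\<close>.\<close>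

lemma card_ends_le:
  assumes g: "graph V E" and nabla: "nabla1_le V E d" and dom: "dominating V E D" and j: "j < 2 * d"
  shows "card (ends E d j (undom E d j))
    \<le> (1 + cands_bound d (2 * d + 1)) ^ (2 * d) * ((2 * d + 1) * card D)"
proof -
  let ?A = "D \<union> scattered V E (2 * d + 1) D"
  have AV: "?A \<subseteq> V" using dom by (auto simp: dominating_def scattered_def)
  note reach = card_reach_le[OF g nabla AV, of "2 * d"]
  have "ends E d j (undom E d j) \<subseteq> reach E d (2 * d) ?A"
  proof
    fix x assume "x \<in> ends E d j (undom E d j)"
    then obtain X where X: "chain E d X x" "card X = 2 * d - j"
      "thr d (Suc j) \<le> card (undom E d j \<inter> (\<Inter>p\<in>X. cnbh E p))" unfolding ends_def by blast
    have "x \<in> reach E d (card X) ?A"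
      using chain_end_reach[OF X(1) chain_meets_dominators[OF g nabla dom j X]] .
    then show "x \<in> reach E d (2 * d) ?A"
      using reach_mono[of "card X" "2 * d" E d ?A] X(2) by auto
  qed
  moreover have "finite (reach E d (2 * d) ?A)"
    using reach g unfolding graph_def by (meson finite_subset)
  ultimately have "card (ends E d j (undom E d j)) \<le> card (reach E d (2 * d) ?A)"
    by (rule card_mono[rotated])
  also have "\<dots> \<le> (1 + cands_bound d (2 * d + 1)) ^ (2 * d) * card ?A" using reach by blast
  also have "card ?A \<le> card D + card (scattered V E (2 * d + 1) D)" by (rule card_Un_le)
  also have "\<dots> \<le> (2 * d + 1) * card D" using card_scattered_le[OF g nabla dom] by simp
  finally show ?thesis by (simp del: cands_bound.simps)
qed

text \<open>At \<open>j = 2 * d\<close> the invariant concerns one-vertex chains: no dominator has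
  \<open>thr d (2 * d)\<close> undominated vertices in its closed neighbourhood.\<close>

lemma card_undom_le:
  assumes g: "graph V E" and nabla: "nabla1_le V E d" and dom: "dominating V E D"
  shows "card (V \<inter> undom E d (2 * d)) \<le> thr d (2 * d) * card D"
proof -
  let ?U = "undom E d (2 * d)"
  have DV: "D \<subseteq> V" using dom by (auto simp: dominating_def)
  have finD: "finite D" using DV g finite_subset unfolding graph_def by blast
  have "V \<inter> ?U \<subseteq> (\<Union>u\<in>D. ?U \<inter> cnbh E u)"
    using dom graph_symp[OF g] unfolding dominating_def cnbh_def by (fastforce dest: sympD)
  then have "card (V \<inter> ?U) \<le> card (\<Union>u\<in>D. ?U \<inter> cnbh E u)"
    using finD finite_cnbh[OF g] by (intro card_mono) auto
  also have "\<dots> \<le> (\<Sum>u\<in>D. card (?U \<inter> cnbh E u))" by (rule card_UN_le[OF finD])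
  also have "\<dots> \<le> (\<Sum>u\<in>D. thr d (2 * d))"
  proof (rule sum_mono)
    fix u
    show "card (?U \<inter> cnbh E u) \<le> thr d (2 * d)"
      using no_thick_chain[OF g nabla _ chain.single[of E d u], of "2 * d"] by simp
  qed
  finally show ?thesis by (simp add: mult.commute)
qed

lemma dom_alg_dominating:
  assumes g: "graph V E"
  shows "dominating V E (V \<inter> dom_alg E d)"
  unfolding dominating_def
proof (intro conjI ballI)
  fix v assume "v \<in> V"
  have *: "v \<in> undom E d i \<or> (\<exists>j<i. \<exists>x\<in>ends E d j (undom E d j). v \<in> cnbh E x)" for i
  proof (induction i)
    case (Suc i)
    then show ?case by (auto simp: less_Suc_eq)
  qed simp
  show "v \<in> V \<inter> dom_alg E d \<or> (\<exists>u\<in>V \<inter> dom_alg E d. E v u)"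
  proof (cases "v \<in> undom E d (2 * d)")
    case True
    then show ?thesis using \<open>v \<in> V\<close> by (simp add: dom_alg_def)
  next
    case False
    with *[of "2 * d"] obtain j x where x: "j < 2 * d" "x \<in> ends E d j (undom E d j)" "v \<in> cnbh E x"
      by blast
    then have "x \<in> V \<inter> dom_alg E d" using ends_subset[OF g] by (auto simp: dom_alg_def)
    moreover have "x = v \<or> E v x" using x(3) graph_symp[OF g] by (auto simp: cnbh_def dest: sympD)
    ultimately show ?thesis by blast
  qed
qed simp

definition dom_factor :: "nat \<Rightarrow> nat" where
  "dom_factor d = 2 * d * ((1 + cands_bound d (2 * d + 1)) ^ (2 * d) * (2 * d + 1)) + thr d (2 * d)"

lemma card_dom_alg_le:
  assumes g: "graph V E" and nabla: "nabla1_le V E d" and dom: "dominating V E D"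
  shows "card (V \<inter> dom_alg E d) \<le> dom_factor d * card D"
proof -
  let ?L = "\<lambda>j. ends E d j (undom E d j)"
  let ?c = "(1 + cands_bound d (2 * d + 1)) ^ (2 * d) * ((2 * d + 1) * card D)"
  have fin: "finite V" using g by (simp add: graph_def)
  have finL: "finite (?L j)" for j by (rule finite_subset[OF ends_subset[OF g] fin])
  have "V \<inter> dom_alg E d \<subseteq> (\<Union>j<2 * d. ?L j) \<union> (V \<inter> undom E d (2 * d))"
    by (auto simp: dom_alg_def)
  then have "card (V \<inter> dom_alg E d) \<le> card ((\<Union>j<2 * d. ?L j) \<union> (V \<inter> undom E d (2 * d)))"
    using fin finL by (intro card_mono) auto
  also have "\<dots> \<le> card (\<Union>j<2 * d. ?L j) + card (V \<inter> undom E d (2 * d))" by (rule card_Un_le)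
  also have "card (\<Union>j<2 * d. ?L j) \<le> (\<Sum>j<2 * d. card (?L j))" by (rule card_UN_le) simp
  also have "\<dots> \<le> (\<Sum>j<2 * d. ?c)"
    by (intro sum_mono card_ends_le[OF g nabla dom]) simp
  also have "\<dots> = 2 * d * ?c" by (simp only: sum_constant card_lessThan of_nat_id)
  also have "card (V \<inter> undom E d (2 * d)) \<le> thr d (2 * d) * card D"
    by (rule card_undom_le[OF g nabla dom])
  also have "2 * d * ?c + thr d (2 * d) * card D = dom_factor d * card D"
    unfolding dom_factor_def by (simp only: algebra_simps)
  finally show ?thesis by simp
qed

section \<open>Locality\<close>

text \<open>Both relations have equal closed neighbourhoods at all vertices at distance less than
  \<open>n\<close> from \<open>v\<close>.\<close>

primrec agree :: "nat \<Rightarrow> (nat \<Rightarrow> nat \<Rightarrow> bool) \<Rightarrow> (nat \<Rightarrow> nat \<Rightarrow> bool) \<Rightarrow> nat \<Rightarrow> bool" where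
  "agree 0 E E' v \<longleftrightarrow> True"
| "agree (Suc n) E E' v \<longleftrightarrow> cnbh E v = cnbh E' v \<and> (\<forall>u\<in>cnbh E v. agree n E E' u)"

lemma agree_sym: "agree n E E' v \<Longrightarrow> agree n E' E v"
  by (induction n arbitrary: v) auto

lemma agree_mono: "agree n E E' v \<Longrightarrow> m \<le> n \<Longrightarrow> agree m E E' v"
proof (induction n arbitrary: m v)
  case (Suc n)
  then show ?case by (cases m) auto
qed simp

lemma agree_two_steps:
  assumes "symp E" "agree (Suc (Suc n)) E E' x" "y \<in> cnbh E x" "y \<in> cnbh E p"
  shows "agree n E E' p"
proof -
  have "p \<in> cnbh E y" using assms cnbh_sym by metis
  then show ?thesis using assms by auto
qed

text \<open>A heavy vertex has a closed neighbourhood meeting \<open>Y\<close>, hence is within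
  distance 1 of \<open>Y\<close>. Recursive calls only shrink \<open>Y\<close>, so the radius does
  not grow with \<open>k\<close>.\<close>

lemma cands_local:
  assumes "symp E" "symp E'"
  shows "(\<And>y. y \<in> Y \<Longrightarrow> agree 2 E E' y) \<Longrightarrow> cands E d k Y = cands E' d k Y"
proof (induction k arbitrary: Y)
  case (Suc k)
  show ?case
  proof (cases "card Y < cand_thr d")
    case False
    then have pos: "card Y > 0" by (simp add: cand_thr_def)
    have near: "agree 1 E E' w" if "cnbh E w \<inter> Y \<noteq> {} \<or> cnbh E' w \<inter> Y \<noteq> {}" for w
    proof -
      from that obtain y where y: "y \<in> Y" "y \<in> cnbh E w \<or> y \<in> cnbh E' w" by blast
      then have "w \<in> cnbh E y \<or> w \<in> cnbh E' y" using assms cnbh_sym by metis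
      then show ?thesis using Suc.prems[OF y(1)] by (auto simp: numeral_2_eq_2)
    qed
    have cn: "cnbh E w = cnbh E' w"
      if "card Y \<le> (2 * d + 1) * card (cnbh E w \<inter> Y) \<or> card Y \<le> (2 * d + 1) * card (cnbh E' w \<inter> Y)" for w
    proof -
      have "cnbh E w \<inter> Y \<noteq> {} \<or> cnbh E' w \<inter> Y \<noteq> {}"
        using that pos by (metis card.empty mult_0_right not_le)
      then show ?thesis using near by auto
    qed
    have W: "{w. card Y \<le> (2 * d + 1) * card (cnbh E w \<inter> Y)} = {w. card Y \<le> (2 * d + 1) * card (cnbh E' w \<inter> Y)}"
      using cn by (metis (no_types, lifting))
    have "(\<Union>w\<in>{w. card Y \<le> (2 * d + 1) * card (cnbh E w \<inter> Y)}. insert w (cands E d k (Y - cnbh E w)))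
      = (\<Union>w\<in>{w. card Y \<le> (2 * d + 1) * card (cnbh E' w \<inter> Y)}. insert w (cands E' d k (Y - cnbh E' w)))"
    proof (rule SUP_cong[OF W])
      fix w assume "w \<in> {w. card Y \<le> (2 * d + 1) * card (cnbh E' w \<inter> Y)}"
      then have "cnbh E w = cnbh E' w" using cn by blast
      moreover have "cands E d k (Y - cnbh E w) = cands E' d k (Y - cnbh E w)"
        by (rule Suc.IH) (use Suc.prems in auto)
      ultimately show "insert w (cands E d k (Y - cnbh E w)) = insert w (cands E' d k (Y - cnbh E' w))"
        by simp
    qed
    then show ?thesis using False by (simp only: cands.simps if_False)
  qed simp
qed simp

lemma ncands_local:
  assumes "symp E" "symp E'" "agree 3 E E' x"
  shows "ncands E d x = ncands E' d x"
proof -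
  have a: "cnbh E x = cnbh E' x" "\<And>y. y \<in> cnbh E x \<Longrightarrow> agree 2 E E' y"
    using assms(3) by (auto simp: numeral_3_eq_3 numeral_2_eq_2)
  show ?thesis using cands_local[OF assms(1,2) a(2)] unfolding a(1) by blast
qed

lemma chain_local:
  assumes "symp E" "symp E'"
  shows "chain E d X x \<Longrightarrow> (\<And>p. p \<in> X \<Longrightarrow> agree 3 E E' p) \<Longrightarrow> chain E' d X x"
proof (induction rule: chain.induct)
  case (single x)
  show ?case by (rule chain.single)
next
  case (extend X x w)
  have "agree 3 E E' x" using extend.prems chain_end[OF extend.hyps(1)] by blast
  then have "w \<in> ncands E' d x" using ncands_local[OF assms] extend.hyps(2) by blast
  then show ?case using extend by (intro chain.extend) auto
qed

text \<open>All vertices of a thick chain share a member of their closed neighbourhoods, so they lie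
  within distance 2 of \<open>x\<close> whatever the length of the chain. Adding radius 3 for
  candidates gives 5.\<close>

lemma ends_local_imp:
  assumes sym: "symp E" "symp E'" and agr: "agree 5 E E' x"
    and U: "\<And>y. y \<in> cnbh E x \<Longrightarrow> y \<in> U \<longleftrightarrow> y \<in> U'" and x: "x \<in> ends E d j U"
  shows "x \<in> ends E' d j U'"
proof -
  from x obtain X where X: "chain E d X x" "card X = 2 * d - j"
    "thr d (Suc j) \<le> card (U \<inter> (\<Inter>p\<in>X. cnbh E p))" unfolding ends_def by blast
  have "U \<inter> (\<Inter>p\<in>X. cnbh E p) \<noteq> {}" using X(3) thr_ge_2[of d "Suc j"]
    by (metis card.empty not_less_eq_eq numeral_2_eq_2 le_trans zero_le)
  then obtain y where y: "\<And>p. p \<in> X \<Longrightarrow> y \<in> cnbh E p" by blast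
  have near: "agree 3 E E' p" if "p \<in> X" for p
  proof (rule agree_two_steps[OF sym(1)])
    show "agree (Suc (Suc 3)) E E' x" using agr by (rule agree_mono) simp
    show "y \<in> cnbh E x" "y \<in> cnbh E p" using y that chain_end[OF X(1)] by auto
  qed
  have cn: "cnbh E p = cnbh E' p" if "p \<in> X" for p
    using agree_mono[OF near[OF that], of 1] by simp
  have "U \<inter> (\<Inter>p\<in>X. cnbh E p) = U' \<inter> (\<Inter>p\<in>X. cnbh E' p)"
    using cn U chain_end[OF X(1)] by auto
  then show ?thesis
    using X chain_local[OF sym X(1) near] unfolding ends_def by auto
qed

lemma ends_local:
  assumes "symp E" "symp E'" "agree 5 E E' x"
    and "\<And>y. y \<in> cnbh E x \<Longrightarrow> y \<in> U \<longleftrightarrow> y \<in> U'"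
  shows "x \<in> ends E d j U \<longleftrightarrow> x \<in> ends E' d j U'"
proof -
  have "cnbh E x = cnbh E' x" using agree_mono[OF assms(3), of 1] by simp
  then show ?thesis
    using ends_local_imp[OF assms] ends_local_imp[OF assms(2,1) agree_sym[OF assms(3)]] assms(4) by blast
qed

text \<open>Each stage costs radius 6: one step to a possible selected neighbour and 5 to decide its
  selection.\<close>

lemma undom_local:
  assumes sym: "symp E" "symp E'"
  shows "agree (6 * j) E E' y \<Longrightarrow> y \<in> undom E d j \<longleftrightarrow> y \<in> undom E' d j"
proof (induction j arbitrary: y)
  case (Suc j)
  have agr: "agree (Suc (6 * j + 5)) E E' y" using Suc.prems by simp
  have "x \<in> ends E d j (undom E d j) \<longleftrightarrow> x \<in> ends E' d j (undom E' d j)" if "x \<in> cnbh E y" for x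
  proof (rule ends_local[OF sym])
    have x: "agree (6 * j + 5) E E' x" using agr that unfolding agree.simps by blast
    then show "agree 5 E E' x" by (rule agree_mono) simp
    fix z assume "z \<in> cnbh E x"
    moreover have "agree (Suc (6 * j)) E E' x" using x by (rule agree_mono) simp
    ultimately show "z \<in> undom E d j \<longleftrightarrow> z \<in> undom E' d j" by (intro Suc.IH) simp
  qed
  moreover have "y \<in> undom E d j \<longleftrightarrow> y \<in> undom E' d j"
    by (rule Suc.IH, rule agree_mono[OF Suc.prems]) simp
  moreover have "cnbh E y = cnbh E' y" using agr unfolding agree.simps by blast
  ultimately show ?case
    using cnbh_sym[OF sym(1)] cnbh_sym[OF sym(2)] by (simp, blast)
qed simp

text \<open>The radius suffices for the last undominated set, which needs
  \<open>6 * (2 * d)\<close>, and for every selection test, which needs 5 and, for the earlier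
  undominated sets, \<open>6 * j + 1\<close>.\<close>

lemma dom_alg_local:
  assumes sym: "symp E" "symp E'" and agr: "agree (12 * d + 5) E E' v"
  shows "v \<in> dom_alg E d \<longleftrightarrow> v \<in> dom_alg E' d"
proof -
  have "v \<in> ends E d j (undom E d j) \<longleftrightarrow> v \<in> ends E' d j (undom E' d j)" if "j < 2 * d" for j
  proof (rule ends_local[OF sym])
    show "agree 5 E E' v" using agr by (rule agree_mono) simp
    fix z assume "z \<in> cnbh E v"
    moreover have "agree (Suc (6 * j)) E E' v" using agr that by (rule_tac agree_mono) auto
    ultimately show "z \<in> undom E d j \<longleftrightarrow> z \<in> undom E' d j" by (intro undom_local[OF sym]) simp
  qed
  moreover have "v \<in> undom E d (2 * d) \<longleftrightarrow> v \<in> undom E' d (2 * d)"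
    by (rule undom_local[OF sym], rule agree_mono[OF agr]) simp
  ultimately show ?thesis by (simp add: dom_alg_def)
qed

section \<open>Full-information gathering\<close>

text \<open>A state, the own identifier with a finite set of known arcs, is packed into one natural
  number because states and messages have type \<open>nat\<close>.\<close>

definition enc :: "nat \<Rightarrow> (nat \<times> nat) set \<Rightarrow> nat" where
  "enc v F = prod_encode (v, set_encode (prod_encode ` F))"

definition id_of :: "nat \<Rightarrow> nat" where
  "id_of s = fst (prod_decode s)"

definition edges_of :: "nat \<Rightarrow> (nat \<times> nat) set" where
  "edges_of s = prod_decode ` set_decode (snd (prod_decode s))"

definition gather :: "nat \<Rightarrow> nat set \<Rightarrow> nat" where
  "gather s M = enc (id_of s)
     (edges_of s \<union> (\<Union>m\<in>M. insert (id_of s, id_of m) (insert (id_of m, id_of s) (edges_of m))))"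

primrec known :: "(nat \<Rightarrow> nat \<Rightarrow> bool) \<Rightarrow> nat \<Rightarrow> nat \<Rightarrow> (nat \<times> nat) set" where
  "known E 0 v = {}"
| "known E (Suc t) v =
     known E t v \<union> (\<Union>u\<in>{u. E v u}. insert (v, u) (insert (u, v) (known E t u)))"

lemma id_of_enc [simp]: "id_of (enc v F) = v"
  by (simp add: id_of_def enc_def)

lemma edges_of_enc [simp]: "finite F \<Longrightarrow> edges_of (enc v F) = F"
  by (simp add: edges_of_def enc_def image_image)

lemma known_subset: "symp E \<Longrightarrow> known E t v \<subseteq> {(a, b). E a b}"
  by (induction t arbitrary: v) (auto dest: sympD)

lemma known_sym: "(a, b) \<in> known E t v \<Longrightarrow> (b, a) \<in> known E t v"
  by (induction t arbitrary: v) auto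

lemma finite_known:
  assumes g: "graph V E"
  shows "finite (known E t v)"
proof (rule finite_subset)
  show "known E t v \<subseteq> V \<times> V"
    using known_subset[OF graph_symp[OF g]] g unfolding graph_def by fast
  show "finite (V \<times> V)" using g by (simp add: graph_def)
qed

lemma local_state_gather:
  assumes g: "graph V E"
  shows "local_state (\<lambda>v. enc v {}) (\<lambda>s. s) gather V E t v = enc v (known E t v)"
proof (induction t arbitrary: v)
  case (Suc t)
  have "{u \<in> V. E v u} = {u. E v u}" using g by (auto simp: graph_def)
  then show ?case
    by (simp add: Suc) (simp add: gather_def finite_known[OF g])
qed simp

text \<open>The set \<open>F\<close> stays fixed during the induction, since what a neighbour knew
  one round earlier is part of \<open>known E (Suc n) v\<close> and so of \<open>F\<close>.\<close>

lemma agree_known: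
  assumes F: "F \<subseteq> {(a, b). E a b}"
  shows "known E n v \<subseteq> F \<Longrightarrow> agree n E (\<lambda>a b. (a, b) \<in> F) v"
proof (induction n arbitrary: v)
  case (Suc n)
  have "(v, u) \<in> F \<longleftrightarrow> E v u" for u using Suc.prems F by auto
  then have "cnbh E v = cnbh (\<lambda>a b. (a, b) \<in> F) v" by (simp add: cnbh_def)
  moreover have "agree n E (\<lambda>a b. (a, b) \<in> F) u" if "u \<in> cnbh E v" for u
    using that Suc.prems by (intro Suc.IH) (auto simp: cnbh_def)
  ultimately show ?case by simp
qed simp

text \<open>Each vertex evaluates \<open>dom_alg\<close> on the graph it has gathered, which agrees
  with \<open>E\<close> up to the radius that its own membership depends on.\<close>

lemma local_output_dom_alg:
  assumes g: "graph V E"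
  shows "local_output (\<lambda>v. enc v {}) (\<lambda>s. s) gather
    (\<lambda>s. id_of s \<in> dom_alg (\<lambda>a b. (a, b) \<in> edges_of s) d) (12 * d + 5) V E = V \<inter> dom_alg E d"
proof -
  let ?F = "\<lambda>v. known E (12 * d + 5) v"
  have "v \<in> dom_alg E d \<longleftrightarrow> v \<in> dom_alg (\<lambda>a b. (a, b) \<in> ?F v) d" for v
  proof (rule dom_alg_local)
    show "symp E" by (rule graph_symp[OF g])
    then show "agree (12 * d + 5) E (\<lambda>a b. (a, b) \<in> ?F v) v"
      by (intro agree_known known_subset subset_refl)
    show "symp (\<lambda>a b. (a, b) \<in> ?F v)" using known_sym by (auto intro: sympI)
  qed
  then show ?thesis
    by (auto simp: local_output_def local_state_gather[OF g] finite_known[OF g])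
qed

lemma domination_number_attained:
  assumes "graph V E"
  obtains D where "dominating V E D" "card D = domination_number V E"
proof -
  have "{D. dominating V E D} \<subseteq> Pow V" by (auto simp: dominating_def)
  then have "finite {D. dominating V E D}"
    using assms finite_subset unfolding graph_def by blast
  moreover have "dominating V E V" by (simp add: dominating_def)
  ultimately have "domination_number V E \<in> card ` {D. dominating V E D}"
    unfolding domination_number_def by (intro Min_in) auto
  then show ?thesis using that by auto
qed

theorem theorem1:
  fixes d :: nat
  assumes "d > 0"
  shows "\<exists>(r::nat) (c::real) (init :: nat \<Rightarrow> nat) (msg :: nat \<Rightarrow> nat)
            (step :: nat \<Rightarrow> nat set \<Rightarrow> nat) (out :: nat \<Rightarrow> bool).
           \<forall>V E. graph V E \<and> nabla1_le V E d \<longrightarrow>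
             dominating V E (local_output init msg step out r V E) \<and>
             real (card (local_output init msg step out r V E))
               \<le> c * real (domination_number V E)"
proof (intro exI allI impI)
  fix V E assume "graph V E \<and> nabla1_le V E d"
  then have g: "graph V E" and nabla: "nabla1_le V E d" by auto
  let ?O = "local_output (\<lambda>v. enc v {}) (\<lambda>s. s) gather
    (\<lambda>s. id_of s \<in> dom_alg (\<lambda>a b. (a, b) \<in> edges_of s) d) (12 * d + 5) V E"
  obtain D where D: "dominating V E D" "card D = domination_number V E"
    by (rule domination_number_attained[OF g])
  have "card ?O \<le> dom_factor d * domination_number V E"
    using card_dom_alg_le[OF g nabla D(1)] D(2) by (simp add: local_output_dom_alg[OF g])
  then have "real (card ?O) \<le> real (dom_factor d * domination_number V E)"
    by (simp only: of_nat_le_iff)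
  \<comment> \<open>This instantiates the witnesses left open by \<open>exI\<close>:
    \<open>12 * d + 5\<close> rounds and the factor \<open>dom_factor d\<close>.\<close>
  then show "dominating V E ?O \<and> real (card ?O) \<le> real (dom_factor d) * real (domination_number V E)"
    using dom_alg_dominating[OF g] by (simp add: local_output_dom_alg[OF g])
qed

end
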